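(* Let $n>3$, let $f:\Omega\subseteq\mathbb{E}_n\to\mathbb{R}$, let $\mathbf{a}_1,\dots,\mathbf{a}_{n+1}\in\Omega$ satisfy $\Delta_{(\mathbf{a}_1,\dots,\mathbf{a}_{n+1})}\neq0$, and suppose that the mirrored points $\overline{\mathbf{a}_1},\dots,\overline{\mathbf{a}_{n-1}}$ lie in $\Omega$. Let $\overline{\mathbf{r}}_{f_{(\mathbf{a}_1,\dots,\mathbf{a}_{n+1})}}=\big(\overline{\Delta}f_{(\mathbf{a}_1,\dots,\mathbf{a}_{n+1})}\big)\big(\Delta_{(\mathbf{a}_1,\dots,\mathbf{a}_{n+1})}\big)^{-1}$, computed in the Clifford algebra $\mathbb{G}_n$. Then $$\overline{\mathbf{r}}_{f_{(\mathbf{a}_1,\dots,\mathbf{a}_{n+1})}}=\left(\sum_{i=1}^{n-1}\frac{f(\overline{\mathbf{a}_i})-f(\mathbf{a}_i)}{\overline{\mathbf{a}_i}-\mathbf{a}_i}\right)+\frac{f(\mathbf{a}_{n+1})-f(\mathbf{a}_n)}{\mathbf{a}_{n+1}-\mathbf{a}_n}.$$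
   Context: $\mathbb{E}_n$ is the $n$-dimensional real Euclidean vector space with scalar product $\mathbf{u}\cdot\mathbf{v}$; its vectors are also called points. $\mathbb{G}_n=\mathcal{C}\ell(\mathbb{E}_n)$ is the Clifford (geometric) algebra generated by $\mathbb{E}_n$, an associative algebra of dimension $2^n$ with product denoted by juxtaposition and $\mathbf{v}\mathbf{v}=\mathbf{v}\cdot\mathbf{v}$ for every vector $\mathbf{v}$. For vectors, $\mathbf{u}_1\wedge\cdots\wedge\mathbf{u}_k=\frac1{k!}\sum_{\sigma\in\mathcal{S}_k}\epsilon_\sigma\,\mathbf{u}_{\sigma_1}\cdots\mathbf{u}_{\sigma_k}$, where $\epsilon_\sigma$ is the sign of $\sigma$. For $\alpha\in\mathbb{R}$ and a non-zero vector $\mathbf{v}$, $\frac{\alpha}{\mathbf{v}}=\alpha\mathbf{v}^{-1}=\frac{\alpha}{|\mathbf{v}|^2}\mathbf{v}$. For points $\mathbf{a}_1,\dots,\mathbf{a}_{n+1}\in\mathbb{E}_n$ define $$\Delta_{(\mathbf{a}_1,\dots,\mathbf{a}_{n+1})}=(\mathbf{a}_2-\mathbf{a}_1)\wedge(\mathbf{a}_3-\mathbf{a}_1)\wedge\cdots\wedge(\mathbf{a}_{n+1}-\mathbf{a}_1).$$ It is non-zero exactly when the points are the vertices of a non degenerate simplex, and it is then invertible in $\mathbb{G}_n$. In that case, for $i=1,\dots,n-1$, let $\overline{\mathbf{a}_i}$ be the mirror image (orthogonal reflection) of $\mathbf{a}_i$ through the affine subspace $\{\nu_{i+1}\mathbf{a}_{i+1}+\cdots+\nu_{n+1}\mathbf{a}_{n+1}:\nu_j\in\mathbb{R},\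 \sum_j\nu_j=1\}$ passing through $\mathbf{a}_{i+1},\dots,\mathbf{a}_{n+1}$; that is, $\overline{\mathbf{a}_i}=2P_i(\mathbf{a}_i)-\mathbf{a}_i$ with $P_i$ the orthogonal projection onto that affine subspace. Define $$\overline{\Delta}_{(\mathbf{a}_1,\dots,\mathbf{a}_{n+1})}=(\overline{\mathbf{a}_1}-\mathbf{a}_1)\wedge\cdots\wedge(\overline{\mathbf{a}_{n-1}}-\mathbf{a}_{n-1}),$$ $$\overline{\Delta^i}_{(\mathbf{a}_1,\dots,\mathbf{a}_{n+1})}=\Bigg(\bigwedge_{j=1,\,j\neq i}^{n-1}(\overline{\mathbf{a}_j}-\mathbf{a}_j)\Bigg)\wedge(\mathbf{a}_{n+1}-\mathbf{a}_n),\qquad i=1,\dots,n-1$$ (factors in increasing order of index). The mean multi-difference pseudo-vector is $$\overline{\Delta}f_{(\mathbf{a}_1,\dots,\mathbf{a}_{n+1})}=\frac1{2^{n-1}}\left\{\sum_{i=1}^{n-1}(-1)^{i+1}[f(\overline{\mathbf{a}_i})-f(\mathbf{a}_i)]\,\overline{\Delta^i}_{(\mathbf{a}_1,\dots,\mathbf{a}_{n+1})}+(-1)^{n+1}[f(\mathbf{a}_{n+1})-f(\mathbf{a}_n)]\,\overline{\Delta}_{(\mathbf{a}_1,\dots,\mathbf{a}_{n+1})}\right\}.$$ *)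

theory Defs
  imports "HOL-Analysis.Analysis" "HOL-Combinatorics.Permutations"
begin

section \<open>The Clifford algebra of a Euclidean space\<close>

text \<open>
  An element of the algebra is given by its coordinates on the basis blades
  \<open>e\<^sub>A\<close> (\<open>A \<subseteq> Basis\<close>), where \<open>e\<^sub>A\<close> is the product of the elements of the orthonormal
  basis \<open>A\<close>, taken in the order of the enumeration \<^term>\<open>to_nat_on Basis\<close> of \<^term>\<open>Basis\<close>.
  The choice of enumeration only affects the algebra up to isomorphism.
\<close>

typedef (overloaded) 'a clifford =
    "{x :: 'a::euclidean_space set \<Rightarrow> real. \<forall>A. \<not> A \<subseteq> Basis \<longrightarrow> x A = 0}"
  morphisms cl_coord Abs_clifford
  by (rule exI[of _ "\<lambda>_. 0"]) auto

setup_lifting type_definition_clifford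

text \<open>
  \<open>e\<^sub>A e\<^sub>B = reorder_sign A B \<cdot> e\<^sub>C\<close> with \<open>C = sym_diff A B\<close>: sorting the factors changes the sign once for
  each pair in \<open>A \<times> B\<close> that is out of order, and repeated factors cancel since \<open>e\<^sub>b e\<^sub>b = 1\<close>.
\<close>

definition reorder_sign :: "'a::euclidean_space set \<Rightarrow> 'a set \<Rightarrow> real" where
  "reorder_sign A B =
     (\<Prod>x\<in>A. \<Prod>y\<in>B. if to_nat_on (Basis :: 'a set) y < to_nat_on (Basis :: 'a set) x then -1 else 1)"

lemma sym_diff_cancel: "sym_diff A (sym_diff A B) = B"
  by auto

lemma prod_sym_diff:
  fixes h :: "'b \<Rightarrow> real"
  assumes "finite A" "finite B" and h: "\<And>x. h x * h x = 1"
  shows "prod h (sym_diff A B) = prod h A * prod h B"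
proof -
  have 1: "prod h (A \<inter> B) * prod h (A \<inter> B) = 1"
    using h by (simp flip: prod.distrib)
  have "prod h A = prod h (A - B) * prod h (A \<inter> B)"
    using assms by (metis prod.Int_Diff mult.commute)
  moreover have "prod h B = prod h (B - A) * prod h (A \<inter> B)"
    using assms by (metis prod.Int_Diff mult.commute Int_commute)
  moreover have "prod h (sym_diff A B) = prod h (A - B) * prod h (B - A)"
    using assms by (intro prod.union_disjoint) auto
  ultimately show ?thesis
    using 1 by (simp add: mult.assoc mult.left_commute)
qed

lemma finite_subset_Basis: "A \<subseteq> (Basis :: 'a::euclidean_space set) \<Longrightarrow> finite A"
  using finite_subset finite_Basis by blast

lemma reorder_sign_left:
  assumes "A \<subseteq> Basis" "B \<subseteq> Basis"
  shows "reorder_sign (sym_diff A B) C = reorder_sign A C * reorder_sign B C"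
  unfolding reorder_sign_def
  using assms by (intro prod_sym_diff) (auto simp: finite_subset_Basis simp flip: prod.distrib intro!: prod.neutral)

lemma reorder_sign_right:
  assumes "B \<subseteq> Basis" "C \<subseteq> Basis"
  shows "reorder_sign A (sym_diff B C) = reorder_sign A B * reorder_sign A C"
proof -
  have "(\<Prod>y\<in>sym_diff B C. if to_nat_on (Basis :: 'a set) y < to_nat_on (Basis :: 'a set) x then -1 else 1 :: real)
    = (\<Prod>y\<in>B. if to_nat_on (Basis :: 'a set) y < to_nat_on (Basis :: 'a set) x then -1 else 1)
    * (\<Prod>y\<in>C. if to_nat_on (Basis :: 'a set) y < to_nat_on (Basis :: 'a set) x then -1 else 1)" for x
    using assms by (intro prod_sym_diff) (auto simp: finite_subset_Basis)
  then show ?thesis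
    unfolding reorder_sign_def by (simp add: prod.distrib)
qed

lemma reorder_sign_empty [simp]: "reorder_sign {} B = 1" "reorder_sign A {} = 1"
  by (simp_all add: reorder_sign_def)

lemma reorder_sign_square: "reorder_sign A B * reorder_sign A B = 1"
  unfolding reorder_sign_def prod.distrib[symmetric] by (intro prod.neutral ballI) auto

instantiation clifford :: (euclidean_space) real_vector
begin

lift_definition zero_clifford :: "'a clifford" is "\<lambda>_. 0" by simp
lift_definition plus_clifford :: "'a clifford \<Rightarrow> 'a clifford \<Rightarrow> 'a clifford" is "\<lambda>x y A. x A + y A" by simp
lift_definition minus_clifford :: "'a clifford \<Rightarrow> 'a clifford \<Rightarrow> 'a clifford" is "\<lambda>x y A. x A - y A" by simp
lift_definition uminus_clifford :: "'a clifford \<Rightarrow> 'a clifford" is "\<lambda>x A. - x A" by simp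
lift_definition scaleR_clifford :: "real \<Rightarrow> 'a clifford \<Rightarrow> 'a clifford" is "\<lambda>c x A. c * x A" by simp

instance
  by standard (transfer; simp add: fun_eq_iff algebra_simps)+

end

instantiation clifford :: (euclidean_space) real_algebra_1
begin

lift_definition one_clifford :: "'a clifford" is "\<lambda>A. if A = {} then 1 else 0" by auto

lift_definition times_clifford :: "'a clifford \<Rightarrow> 'a clifford \<Rightarrow> 'a clifford" is
  "\<lambda>x y C. if C \<subseteq> Basis
     then \<Sum>A\<in>Pow Basis. reorder_sign A (sym_diff A C) * x A * y (sym_diff A C) else 0"
  by simp

instance
proof
  fix x y z :: "'a clifford" and c :: real
  show "x * y * z = x * (y * z)"
  proof (transfer, rule ext)
    fix x y z :: "'a set \<Rightarrow> real" and D :: "'a set"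
    let ?P = "Pow (Basis :: 'a set)"
    let ?s = "reorder_sign :: 'a set \<Rightarrow> 'a set \<Rightarrow> real"
    let ?t = "\<lambda>x y C. if C \<subseteq> Basis
      then \<Sum>A\<in>?P. ?s A (sym_diff A C) * x A * y (sym_diff A C) else 0"
    show "?t (?t x y) z D = ?t x (?t y z) D"
    proof (cases "D \<subseteq> Basis")
      case D: True
      have sub: "sym_diff A B \<subseteq> Basis" if "A \<subseteq> Basis" "B \<subseteq> Basis" for A B :: "'a set"
        using that by blast
      have "?t (?t x y) z D = (\<Sum>C\<in>?P. \<Sum>A\<in>?P.
          ?s C (sym_diff C D) * (?s A (sym_diff A C) * x A * y (sym_diff A C)) * z (sym_diff C D))"
        using D by (simp add: sum_distrib_left sum_distrib_right)
      also have "\<dots> = (\<Sum>A\<in>?P. \<Sum>C\<in>?P.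
          ?s C (sym_diff C D) * (?s A (sym_diff A C) * x A * y (sym_diff A C)) * z (sym_diff C D))"
        by (rule sum.swap)
      also have "\<dots> = (\<Sum>A\<in>?P. \<Sum>B\<in>?P.
          ?s A (sym_diff A D) * x A * (?s B (sym_diff B (sym_diff A D)) * y B * z (sym_diff B (sym_diff A D))))"
      proof (rule sum.cong[OF refl])
        fix A assume "A \<in> ?P"
        then have A: "A \<subseteq> Basis" by simp
        show "(\<Sum>C\<in>?P.
            ?s C (sym_diff C D) * (?s A (sym_diff A C) * x A * y (sym_diff A C)) * z (sym_diff C D))
          = (\<Sum>B\<in>?P.
          ?s A (sym_diff A D) * x A * (?s B (sym_diff B (sym_diff A D)) * y B * z (sym_diff B (sym_diff A D))))"
        proof (rule sum.reindex_bij_witness[where i = "sym_diff A" and j = "sym_diff A"])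
          fix C assume "C \<in> ?P"
          then have C: "C \<subseteq> Basis" by simp
          define B where "B = sym_diff A C"
          define E where "E = sym_diff C D"
          have B: "B \<subseteq> Basis" and E: "E \<subseteq> Basis" using A C D unfolding B_def E_def by blast+
          have "C = sym_diff A B" "sym_diff A D = sym_diff B E" "sym_diff B (sym_diff A D) = E"
            unfolding B_def E_def by blast+
          moreover have "?s (sym_diff A B) E * ?s A B = ?s A (sym_diff B E) * ?s B E"
            using reorder_sign_left[OF A B] reorder_sign_right[OF B E] by simp
          ultimately have eq: "sym_diff (sym_diff A C) (sym_diff A D) = E" "sym_diff A C = B" "sym_diff C D = E"
              "sym_diff B (sym_diff A D) = E"
            and sg: "?s C E * ?s A B = ?s A (sym_diff A D) * ?s B E"
            unfolding B_def E_def by simp_all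
          show "?s A (sym_diff A D) * x A *
              (?s (sym_diff A C) (sym_diff (sym_diff A C) (sym_diff A D)) * y (sym_diff A C) *
               z (sym_diff (sym_diff A C) (sym_diff A D)))
            = ?s C (sym_diff C D) * (?s A (sym_diff A C) * x A * y (sym_diff A C)) * z (sym_diff C D)"
            unfolding eq using arg_cong[OF sg, of "\<lambda>t. t * (x A * y B * z E)"]
            by (simp only: mult_ac)
        qed (use A in blast)+
      qed
      also have "\<dots> = ?t x (?t y z) D"
        using D sub[OF _ D] by (auto simp: sum_distrib_left intro!: sum.cong)
      finally show ?thesis .
    qed simp
  qed
  show "(x + y) * z = x * z + y * z" "x * (y + z) = x * y + x * z"
    by (transfer; simp add: fun_eq_iff algebra_simps sum.distrib)+
  show "1 * x = x"
    by (transfer; rule ext)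
      (auto simp: sum.delta if_distrib[of "\<lambda>u. _ * u * _"] if_distrib[of "\<lambda>u. u * _"] finite_Pow_iff cong: if_cong)
  show "x * 1 = x"
  proof (transfer, rule ext)
    fix x :: "'a set \<Rightarrow> real" and C :: "'a set"
    assume x: "\<forall>A. \<not> A \<subseteq> Basis \<longrightarrow> x A = 0"
    have "sym_diff A C = {} \<longleftrightarrow> A = C" for A :: "'a set" by blast
    then have "(\<Sum>A\<in>Pow Basis. reorder_sign A (sym_diff A C) * x A * (if sym_diff A C = {} then 1 else 0))
      = (\<Sum>A\<in>Pow Basis. if A = C then x A else 0)"
      by (intro sum.cong) auto
    then show "(if C \<subseteq> Basis
         then \<Sum>A\<in>Pow Basis. reorder_sign A (sym_diff A C) * x A * (if sym_diff A C = {} then 1 else 0)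
         else 0) = x C"
      using x by (simp add: finite_Pow_iff)
  qed
  show "(0::'a clifford) \<noteq> 1"
    by transfer (auto simp: fun_eq_iff)
  show "c *\<^sub>R x * y = c *\<^sub>R (x * y)" "x * c *\<^sub>R y = c *\<^sub>R (x * y)"
    by (transfer; auto simp: fun_eq_iff sum_distrib_left intro!: sum.cong)+
qed

end

instantiation clifford :: (euclidean_space) inverse
begin

definition inverse_clifford :: "'a clifford \<Rightarrow> 'a clifford" where
  "inverse (x :: 'a clifford) = (if \<exists>y. x * y = 1 \<and> y * x = 1 then THE y. x * y = 1 \<and> y * x = 1 else 0)"

definition divide_clifford :: "'a clifford \<Rightarrow> 'a clifford \<Rightarrow> 'a clifford" where
  "x div y = x * inverse (y :: 'a clifford)"

instance ..

end

lemma clifford_inverse_eqI: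
  fixes x y :: "'a::euclidean_space clifford"
  assumes "x * y = 1" "y * x = 1"
  shows "inverse x = y"
proof -
  have "z = y" if "z * x = 1" for z
  proof -
    have "z = z * (x * y)" by (simp only: assms mult_1_right)
    also have "\<dots> = y" by (simp only: that mult_1_left flip: mult.assoc)
    finally show ?thesis .
  qed
  then have "(THE y. x * y = 1 \<and> y * x = 1) = y"
    using assms by (intro the_equality) blast+
  moreover have "\<exists>y. x * y = 1 \<and> y * x = 1"
    using assms by blast
  ultimately show ?thesis
    unfolding inverse_clifford_def by (simp only: if_True)
qed

text \<open>The embedding of the vectors.\<close>

lift_definition cl_vec :: "'a::euclidean_space \<Rightarrow> 'a clifford" is
  "\<lambda>v A. \<Sum>b\<in>Basis. if A = {b} then v \<bullet> b else 0"
  by (auto intro!: sum.neutral)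

text \<open>
  The facts \<open>linear_cl_vec\<close>, \<open>cl_vec_square\<close>, \<open>clifford_generated\<close> and \<open>dim_clifford\<close> below characterize
  the Clifford algebra.
\<close>

lift_definition cl_blade :: "'a::euclidean_space set \<Rightarrow> 'a clifford" is
  "\<lambda>B A. if A = B \<and> B \<subseteq> Basis then 1 else 0"
  by auto

lemma linear_cl_vec: "linear (cl_vec :: 'a::euclidean_space \<Rightarrow> _)"
proof (rule linearI)
  show "cl_vec (u + v) = cl_vec u + cl_vec v" for u v :: 'a
    by (transfer; rule ext; subst sum.distrib[symmetric]; rule sum.cong) (auto simp: inner_add_left)
  show "cl_vec (c *\<^sub>R v) = c *\<^sub>R cl_vec v" for c and v :: 'a
    by (transfer; rule ext; subst sum_distrib_left; rule sum.cong) auto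
qed

lemma cl_coord_sum: "cl_coord (sum g S) A = (\<Sum>i\<in>S. cl_coord (g i) A)"
  by (induction S rule: infinite_finite_induct) (simp_all add: zero_clifford.rep_eq plus_clifford.rep_eq)

lemma cl_blade_mult:
  assumes "A \<subseteq> Basis" "B \<subseteq> Basis"
  shows "cl_blade A * cl_blade B = reorder_sign A B *\<^sub>R cl_blade (sym_diff A B)"
  using assms
proof (transfer, intro ext)
  fix A B C :: "'a set"
  assume AB: "A \<subseteq> Basis" "B \<subseteq> Basis"
  have "(\<Sum>D\<in>Pow Basis. reorder_sign D (sym_diff D C) * (if D = A \<and> A \<subseteq> Basis then 1 else 0)
      * (if sym_diff D C = B \<and> B \<subseteq> Basis then 1 else 0))
    = (\<Sum>D\<in>Pow Basis. if D = A then reorder_sign A B * (if sym_diff A C = B then 1 else 0) else 0)"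
    using AB by (intro sum.cong) auto
  also have "\<dots> = reorder_sign A B * (if sym_diff A C = B then 1 else 0)"
    using AB by (simp add: finite_Pow_iff)
  also have "sym_diff A C = B \<longleftrightarrow> C = sym_diff A B"
    using sym_diff_cancel by metis
  finally show "(if C \<subseteq> Basis then \<Sum>D\<in>Pow Basis. reorder_sign D (sym_diff D C)
      * (if D = A \<and> A \<subseteq> Basis then 1 else 0) * (if sym_diff D C = B \<and> B \<subseteq> Basis then 1 else 0) else 0)
    = reorder_sign A B * (if C = sym_diff A B \<and> sym_diff A B \<subseteq> Basis then 1 else 0)"
    using AB by auto
qed

lemma cl_blade_empty: "cl_blade {} = 1"
  by transfer auto

lemma cl_blade_singleton: "b \<in> Basis \<Longrightarrow> cl_blade {b} = cl_vec b"
proof (transfer, rule ext)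
  fix b :: 'a and A :: "'a set"
  assume b: "b \<in> Basis"
  then have "(\<Sum>c\<in>Basis. if A = {c} then b \<bullet> c else 0) = (\<Sum>c\<in>Basis. if c = b then (if A = {b} then 1 else 0) else 0)"
    by (intro sum.cong) (auto simp: inner_Basis)
  then show "(if A = {b} \<and> {b} \<subseteq> Basis then 1 else 0) = (\<Sum>c\<in>Basis. if A = {c} then b \<bullet> c else 0)"
    using b by simp
qed

lemma cl_vec_expand: "cl_vec v = (\<Sum>b\<in>Basis. (v \<bullet> b) *\<^sub>R cl_vec b)"
proof -
  have "cl_vec v = cl_vec (\<Sum>b\<in>Basis. (v \<bullet> b) *\<^sub>R b)"
    by (simp add: euclidean_representation)
  then show ?thesis
    by (simp add: linear_sum[OF linear_cl_vec] linear_cmul[OF linear_cl_vec])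
qed

lemma cl_vec_Basis_mult:
  fixes b c :: "'a::euclidean_space"
  assumes "b \<in> Basis" "c \<in> Basis"
  shows "cl_vec b * cl_vec c + cl_vec c * cl_vec b = (2 * (b \<bullet> c)) *\<^sub>R 1"
proof (cases "b = c")
  case True
  have "cl_vec b * cl_vec b = 1"
    using cl_blade_mult[of "{b}" "{b}"] assms
    by (simp add: cl_blade_singleton cl_blade_empty reorder_sign_def)
  then show ?thesis
    using True assms by (simp add: scaleR_2)
next
  case False
  have "to_nat_on Basis b \<noteq> to_nat_on Basis c"
    using False assms by (simp add: countable_finite)
  then have "reorder_sign {b} {c} = - reorder_sign {c} {b}"
    by (auto simp: reorder_sign_def)
  moreover have "sym_diff {b} {c} = sym_diff {c} {b}"
    by blast
  ultimately have "cl_blade {b} * cl_blade {c} = - (cl_blade {c} * cl_blade {b})"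
    using assms by (simp add: cl_blade_mult)
  then show ?thesis
    using False assms by (simp add: cl_blade_singleton inner_Basis)
qed

lemma cl_vec_anticommute:
  fixes u v :: "'a::euclidean_space"
  shows "cl_vec u * cl_vec v + cl_vec v * cl_vec u = (2 * (u \<bullet> v)) *\<^sub>R 1"
proof -
  have "cl_vec u * cl_vec v + cl_vec v * cl_vec u
    = (\<Sum>b\<in>Basis. \<Sum>c\<in>Basis. ((u \<bullet> b) * (v \<bullet> c)) *\<^sub>R (cl_vec b * cl_vec c + cl_vec c * cl_vec b))"
  proof -
    have prod: "cl_vec p * cl_vec q = (\<Sum>b\<in>Basis. \<Sum>c\<in>Basis. ((p \<bullet> b) * (q \<bullet> c)) *\<^sub>R (cl_vec b * cl_vec c))"
      for p q :: 'a
      by (subst cl_vec_expand[of p], subst cl_vec_expand[of q])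
        (simp only: sum_product mult_scaleR_left mult_scaleR_right scaleR_scaleR
          mult.commute[of "q \<bullet> _"])
    have "cl_vec v * cl_vec u = (\<Sum>b\<in>Basis. \<Sum>c\<in>Basis. ((u \<bullet> b) * (v \<bullet> c)) *\<^sub>R (cl_vec c * cl_vec b))"
      unfolding prod[of v u] by (subst sum.swap) (simp only: mult.commute[of "v \<bullet> _"])
    then show ?thesis
      by (simp add: prod[of u v] scaleR_add_right sum.distrib)
  qed
  also have "\<dots> = (\<Sum>b\<in>Basis. \<Sum>c\<in>Basis. ((u \<bullet> b) * (v \<bullet> c)) *\<^sub>R ((2 * (b \<bullet> c)) *\<^sub>R 1))"
    by (intro sum.cong refl) (simp add: cl_vec_Basis_mult)
  also have "\<dots> = (\<Sum>b\<in>Basis. \<Sum>c\<in>Basis. if c = b then (2 * (u \<bullet> b) * (v \<bullet> b)) *\<^sub>R 1 else 0)"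
    by (intro sum.cong refl) (auto simp: inner_Basis)
  also have "\<dots> = (\<Sum>b\<in>Basis. 2 * (u \<bullet> b) * (v \<bullet> b)) *\<^sub>R 1"
    by (simp add: scaleR_sum_left)
  also have "(\<Sum>b\<in>Basis. 2 * (u \<bullet> b) * (v \<bullet> b)) = 2 * (u \<bullet> v)"
    by (simp add: euclidean_inner[of u v] sum_distrib_left mult.assoc)
  finally show ?thesis .
qed

lemma cl_vec_square: "cl_vec v * cl_vec v = (v \<bullet> v) *\<^sub>R 1"
proof -
  have "2 *\<^sub>R (cl_vec v * cl_vec v) = 2 *\<^sub>R ((v \<bullet> v) *\<^sub>R 1)"
    using cl_vec_anticommute[of v v] by (simp add: scaleR_2)
  then show ?thesis by (metis scaleR_cancel_left zero_neq_numeral)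
qed

lemma cl_blade_expand: "x = (\<Sum>A\<in>Pow Basis. cl_coord x A *\<^sub>R cl_blade A)"
proof -
  have "cl_coord x C = cl_coord (\<Sum>A\<in>Pow Basis. cl_coord x A *\<^sub>R cl_blade A) C" for C
  proof -
    have "cl_coord (\<Sum>A\<in>Pow Basis. cl_coord x A *\<^sub>R cl_blade A) C
      = (\<Sum>A\<in>Pow Basis. if C = A then cl_coord x A else 0)"
      unfolding cl_coord_sum
      by (intro sum.cong) (auto simp: scaleR_clifford.rep_eq cl_blade.rep_eq)
    also have "\<dots> = cl_coord x C"
      using cl_coord[of x] by (auto simp: finite_Pow_iff)
    finally show ?thesis by simp
  qed
  then show ?thesis
    by (intro cl_coord_inject[THEN iffD1] ext)
qed

lemma clifford_generated:
  "span (range (\<lambda>vs :: 'a::euclidean_space list. prod_list (map cl_vec vs))) = (UNIV :: 'a clifford set)"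
  (is "span ?R = _")
proof -
  have closed: "cl_vec b * x \<in> span ?R" if "x \<in> span ?R" for b :: 'a and x
    using that
  proof (induction rule: span_induct_alt)
    case base
    show ?case by (simp add: span_zero)
  next
    case (step c x y)
    from step(1) obtain vs where "x = prod_list (map cl_vec vs)" by auto
    then have "cl_vec b * x = prod_list (map cl_vec (b # vs))" by simp
    then have "cl_vec b * x \<in> ?R" by blast
    with step(2) show ?case
      by (simp add: distrib_left span_add span_scale span_base)
  qed
  have blade: "cl_blade A \<in> span ?R" if "finite A" "A \<subseteq> Basis" for A :: "'a set"
    using that
  proof (induction A rule: finite_induct)
    case empty
    have "prod_list (map cl_vec ([] :: 'a list)) \<in> span ?R"
      by (intro span_base) blast
    then show ?case by (simp add: cl_blade_empty)
  next
    case (insert b A)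
    have b: "b \<in> Basis" "A \<subseteq> Basis" using insert by auto
    have "sym_diff {b} A = insert b A" using insert by auto
    then have "cl_vec b * cl_blade A = reorder_sign {b} A *\<^sub>R cl_blade (insert b A)"
      using cl_blade_mult[of "{b}" A] b by (simp add: cl_blade_singleton)
    then have "cl_blade (insert b A) = reorder_sign {b} A *\<^sub>R (cl_vec b * cl_blade A)"
      by (simp add: reorder_sign_square)
    then show ?case
      using insert b closed by (simp add: span_scale)
  qed
  have "x \<in> span ?R" for x :: "'a clifford"
    by (subst cl_blade_expand[of x]) (auto intro!: span_sum span_scale blade simp: finite_subset_Basis)
  then show ?thesis by blast
qed

lemma dim_clifford: "dim (UNIV :: 'a::euclidean_space clifford set) = 2 ^ DIM('a)"
proof -
  let ?P = "Pow (Basis :: 'a set)"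
  have inj: "inj_on cl_blade ?P"
    by (intro inj_onI) (auto simp: cl_coord_inject[symmetric] fun_eq_iff cl_blade.rep_eq split: if_splits)
  have "independent (cl_blade ` ?P)"
  proof (rule independent_if_scalars_zero)
    show "finite (cl_blade ` ?P)" by (simp add: finite_Pow_iff)
  next
    fix f and x :: "'a clifford"
    assume 0: "(\<Sum>x\<in>cl_blade ` ?P. f x *\<^sub>R x) = 0" and "x \<in> cl_blade ` ?P"
    then obtain A where A: "A \<subseteq> Basis" "x = cl_blade A" by auto
    have "0 = cl_coord (\<Sum>B\<in>?P. f (cl_blade B) *\<^sub>R cl_blade B) A"
      using 0 by (simp add: sum.reindex[OF inj] zero_clifford.rep_eq)
    also have "\<dots> = (\<Sum>B\<in>?P. if B = A then f (cl_blade A) else 0)"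
      unfolding cl_coord_sum
      by (intro sum.cong) (auto simp: scaleR_clifford.rep_eq cl_blade.rep_eq)
    also have "\<dots> = f x"
      using A by (simp add: finite_Pow_iff)
    finally show "f x = 0" by simp
  qed
  moreover have "UNIV \<subseteq> span (cl_blade ` ?P)"
  proof
    fix x :: "'a clifford"
    show "x \<in> span (cl_blade ` ?P)"
      by (subst cl_blade_expand[of x]) (intro span_sum span_scale span_base imageI)
  qed
  ultimately have "dim (UNIV :: 'a clifford set) = card (cl_blade ` ?P)"
    by (intro dim_eq_card[symmetric] dim_unique) auto
  then show ?thesis
    by (simp add: card_image[OF inj] card_Pow)
qed

lemma cl_divide_vec:
  assumes "v \<noteq> 0"
  shows "of_real c / cl_vec v = cl_vec ((c / (norm v)\<^sup>2) *\<^sub>R v)"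
proof -
  have 1: "cl_vec v * cl_vec ((1 / (norm v)\<^sup>2) *\<^sub>R v) = 1" "cl_vec ((1 / (norm v)\<^sup>2) *\<^sub>R v) * cl_vec v = 1"
    using assms by (simp_all add: linear_cmul[OF linear_cl_vec] cl_vec_square power2_norm_eq_inner)
  show ?thesis
    by (simp add: divide_clifford_def clifford_inverse_eqI[OF 1] linear_cmul[OF linear_cl_vec] of_real_def)
qed

text \<open>The outer product \<open>u\<^sub>1 \<and> \<dots> \<and> u\<^sub>k\<close> of a list of vectors, here indexed from 0.\<close>

definition wedge :: "'a::euclidean_space list \<Rightarrow> 'a clifford" where
  "wedge us = (1 / fact (length us)) *\<^sub>R
     (\<Sum>\<sigma> | \<sigma> permutes {..<length us}.
        real_of_int (sign \<sigma>) *\<^sub>R prod_list (map (\<lambda>i. cl_vec (us ! \<sigma> i)) [0..<length us]))"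

section \<open>Mean multi-differences\<close>

definition orth_proj :: "'a::euclidean_space set \<Rightarrow> 'a \<Rightarrow> 'a" where
  "orth_proj S x = (THE p. p \<in> S \<and> (\<forall>u\<in>S. \<forall>w\<in>S. orthogonal (x - p) (u - w)))"

lemma orth_proj_affine:
  fixes S :: "'a::euclidean_space set"
  assumes "affine S" "S \<noteq> {}"
  shows "orth_proj S x \<in> S" "u \<in> S \<Longrightarrow> w \<in> S \<Longrightarrow> orthogonal (x - orth_proj S x) (u - w)"
proof -
  obtain a where a: "a \<in> S" using assms by auto
  define T where "T = (\<lambda>y. y - a) ` S"
  have T: "subspace T"
    unfolding T_def using affine_diffs_subspace_subtract[OF assms(1) a] .
  have inT: "s - a \<in> T" if "s \<in> S" for s
    unfolding T_def using that by (rule imageI)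
  obtain y z where yz: "y \<in> span T" "\<And>w. w \<in> span T \<Longrightarrow> orthogonal z w" "x - a = y + z"
    using orthogonal_subspace_decomp_exists[of T "x - a"] by blast
  have yT: "y \<in> T" using yz(1) T by (metis span_eq_iff)
  have ex: "\<exists>!p. p \<in> S \<and> (\<forall>u\<in>S. \<forall>w\<in>S. orthogonal (x - p) (u - w))"
  proof (intro ex1I conjI ballI)
    show "y + a \<in> S" using yT by (auto simp: T_def)
    fix u w assume "u \<in> S" "w \<in> S"
    then have "(u - a) - (w - a) \<in> T"
      using subspace_diff[OF T] inT by blast
    moreover have "x - (y + a) = z" using yz(3) by (simp add: algebra_simps)
    ultimately show "orthogonal (x - (y + a)) (u - w)"
      using yz(2) by (simp add: span_base)
  next
    fix p assume p: "p \<in> S \<and> (\<forall>u\<in>S. \<forall>w\<in>S. orthogonal (x - p) (u - w))"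
    have q: "y + a \<in> S" using yT by (auto simp: T_def)
    have "p - (y + a) \<in> T"
    proof -
      have "(p - a) - y \<in> T" using subspace_diff[OF T] inT yT p by blast
      then show ?thesis by (simp add: algebra_simps)
    qed
    then have "orthogonal z (p - (y + a))" using yz(2) by (simp add: span_base)
    moreover have "orthogonal (x - p) (p - (y + a))" using p q by blast
    moreover have "z = x - (y + a)" using yz(3) by (simp add: algebra_simps)
    ultimately have "((x - (y + a)) - (x - p)) \<bullet> (p - (y + a)) = 0"
      unfolding orthogonal_def inner_diff_left[of "x - (y + a)"] by simp
    moreover have "(x - (y + a)) - (x - p) = p - (y + a)" by (simp add: algebra_simps)
    ultimately have "p - (y + a) = 0" by (metis inner_eq_zero_iff)
    then show "p = y + a" by simp
  qed
  show "orth_proj S x \<in> S" "u \<in> S \<Longrightarrow> w \<in> S \<Longrightarrow> orthogonal (x - orth_proj S x) (u - w)"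
    using theI'[OF ex, folded orth_proj_def] by simp_all
qed

text \<open>
  Throughout, \<open>n = DIM('a)\<close> and a tuple of points \<open>a\<^sub>1, \<dots>, a\<^sub>n\<^sub>+\<^sub>1\<close> is a function on \<^typ>\<open>nat\<close>, of which only
  the values at the indices \<open>1, \<dots>, n + 1\<close> matter.
\<close>

definition simplex_blade :: "(nat \<Rightarrow> 'a::euclidean_space) \<Rightarrow> 'a clifford" where
  "simplex_blade a = wedge (map (\<lambda>j. a j - a 1) [2..<DIM('a) + 2])"

definition mirror :: "(nat \<Rightarrow> 'a::euclidean_space) \<Rightarrow> nat \<Rightarrow> 'a" where
  "mirror a i = 2 *\<^sub>R orth_proj (affine hull (a ` {i + 1..DIM('a) + 1})) (a i) - a i"

definition mirror_blade :: "(nat \<Rightarrow> 'a::euclidean_space) \<Rightarrow> 'a clifford" where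
  "mirror_blade a = wedge (map (\<lambda>j. mirror a j - a j) [1..<DIM('a)])"

definition mirror_blade_omit :: "(nat \<Rightarrow> 'a::euclidean_space) \<Rightarrow> nat \<Rightarrow> 'a clifford" where
  "mirror_blade_omit a i =
     wedge (map (\<lambda>j. mirror a j - a j) (filter (\<lambda>j. j \<noteq> i) [1..<DIM('a)])
            @ [a (DIM('a) + 1) - a (DIM('a))])"

definition mean_multidiff :: "('a::euclidean_space \<Rightarrow> real) \<Rightarrow> (nat \<Rightarrow> 'a) \<Rightarrow> 'a clifford" where
  "mean_multidiff f a = (1 / 2 ^ (DIM('a) - 1)) *\<^sub>R
     ((\<Sum>i = 1..DIM('a) - 1. ((-1) ^ (i + 1) * (f (mirror a i) - f (a i))) *\<^sub>R mirror_blade_omit a i)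
      + ((-1) ^ (DIM('a) + 1) * (f (a (DIM('a) + 1)) - f (a (DIM('a))))) *\<^sub>R mirror_blade a)"

end

theory Submission
  imports Defs
begin

text \<open>
  Put \<open>n = DIM('a)\<close>, \<open>d\<^sub>i = mirror a i - a i\<close> for \<open>1 \<le> i < n\<close> and \<open>d\<^sub>n = a (n + 1) - a n\<close>. The point is that
  the vectors \<open>d\<^sub>1, \<dots>, d\<^sub>n\<close> are pairwise orthogonal: for \<open>i < n\<close> the vector \<open>d\<^sub>i\<close> is twice the altitude
  dropped from \<open>a i\<close> to the affine hull of the later vertices, whereas all \<open>d\<^sub>j\<close> with \<open>j > i\<close> are
  parallel to that hull (\<open>frame_orthogonal\<close>). For pairwise orthogonal vectors the outer
  product is the Clifford product (\<open>wedge_orthogonal\<close>), so that the blades of mirror differences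
  are words in anticommuting invertible letters, and dropping a letter from a word can be
  undone by multiplying with that letter.

  More precisely, let \<open>D = d\<^sub>1 \<dots> d\<^sub>n\<close>. Moving \<open>d\<^sub>i\<close> to the front of \<open>D\<close> passes \<open>i - 1\<close> anticommuting
  factors, hence \<open>d\<^sub>1 \<dots> d\<^sub>i\<^sub>-\<^sub>1 d\<^sub>i\<^sub>+\<^sub>1 \<dots> d\<^sub>n = (-1)\<^sup>i\<^sup>-\<^sup>1 d\<^sub>i\<^sup>-\<^sup>1 D\<close> (\<open>omit_mult_inverse\<close>). The factor \<open>(-1)\<^sup>i\<^sup>-\<^sup>1\<close>
  cancels the sign \<open>(-1)\<^sup>i\<^sup>+\<^sup>1\<close> in the mean multi-difference, for \<open>i = n\<close> as well as for \<open>i < n\<close>.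

  It remains to compare \<open>D\<close> with the blade of the simplex. The outer product is multilinear and
  alternating, so it does not change when a combination of the other factors is added to one
  factor (\<open>wedge_add_span\<close>). This permits a Gram-Schmidt process which replaces the edges of the
  simplex one by one with its altitudes (\<open>wedge_altitude_step\<close>); as the altitudes are the halves of
  \<open>d\<^sub>1, \<dots>, d\<^sub>n\<^sub>-\<^sub>1\<close>, the simplex blade is \<open>D / 2\<^sup>n\<^sup>-\<^sup>1\<close> (\<open>simplex_blade_frame\<close>), which accounts for the
  normalizing factor. By the same formula non-degeneracy of the simplex means \<open>D \<noteq> 0\<close>, which forces
  every \<open>d\<^sub>i\<close> to be non-zero and therefore invertible.
\<close>

section \<open>Anticommuting factors\<close>

lemma anticommute_prod_list:
  fixes x :: "'b::ring_1"
  assumes "\<And>z. z \<in> set zs \<Longrightarrow> x * z = - (z * x)"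
  shows "x * prod_list zs = (-1) ^ length zs * (prod_list zs * x)"
  using assms
proof (induction zs)
  case (Cons z zs)
  have "x * (z * prod_list zs) = - (z * (x * prod_list zs))"
    using Cons.prems[of z] by (simp flip: mult.assoc)
  also have "\<dots> = - (z * ((-1) ^ length zs * (prod_list zs * x)))"
    using Cons by simp
  also have "z * (-1) ^ length zs = (-1) ^ length zs * z"
    by (cases "even (length zs)") simp_all
  then have "- (z * ((-1) ^ length zs * (prod_list zs * x)))
      = (-1) ^ length (z # zs) * (prod_list (z # zs) * x)"
    by (simp flip: mult.assoc)
  finally show ?case by simp
qed simp

text \<open>
  Carrying \<open>x\<close> and \<open>y\<close> across the block \<open>m\<close> produces the same sign twice; only the sign of the exchange
  of \<open>x\<close> with \<open>y\<close> survives.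
\<close>

lemma prod_list_swap:
  fixes x y :: "'b::ring_1"
  assumes "x * y = - (y * x)"
    and "\<And>z. z \<in> set m \<Longrightarrow> x * z = - (z * x)" and "\<And>z. z \<in> set m \<Longrightarrow> y * z = - (z * y)"
  shows "prod_list (p @ y # m @ x # q) = - prod_list (p @ x # m @ y # q)"
proof -
  define M where "M = prod_list m"
  define s :: 'b where "s = (-1) ^ length m"
  have x: "x * M = s * (M * x)" and y: "y * M = s * (M * y)"
    unfolding M_def s_def by (intro anticommute_prod_list assms; assumption)+
  have "y * M * x = s * (M * (y * x))"
    by (simp add: y mult.assoc)
  also have "\<dots> = - (x * M * y)"
    by (simp add: x mult.assoc assms(1))
  finally have "prod_list p * (y * M * x) * prod_list q = - (prod_list p * (x * M * y) * prod_list q)"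
    by simp
  then show ?thesis
    by (simp add: M_def mult.assoc)
qed

lemma upt_split_at: "i \<le> k \<Longrightarrow> k < j \<Longrightarrow> [i..<j] = [i..<k] @ k # [Suc k..<j]"
  by (metis le_Suc_ex less_imp_le upt_add_eq_append upt_conv_Cons le_add_diff_inverse)

lemma prod_list_transpose:
  fixes V :: "nat \<Rightarrow> 'b::ring_1"
  assumes V: "\<And>i j. i < n \<Longrightarrow> j < n \<Longrightarrow> i \<noteq> j \<Longrightarrow> V i * V j = - (V j * V i)"
    and ab: "a < b" "b < n"
  shows "prod_list (map (\<lambda>i. V (Transposition.transpose a b i)) [0..<n]) = - prod_list (map V [0..<n])"
proof -
  have split: "[0..<n] = [0..<a] @ a # [Suc a..<b] @ b # [Suc b..<n]"
    using ab upt_split_at[of 0 a n] upt_split_at[of "Suc a" b n] by simp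
  have "map (\<lambda>i. V (Transposition.transpose a b i)) [0..<n]
      = map V [0..<a] @ V b # map V [Suc a..<b] @ V a # map V [Suc b..<n]"
    unfolding split using ab by (auto simp: Transposition.transpose_def)
  moreover have "map V [0..<n] = map V [0..<a] @ V a # map V [Suc a..<b] @ V b # map V [Suc b..<n]"
    unfolding split by simp
  moreover have "prod_list (map V [0..<a] @ V b # map V [Suc a..<b] @ V a # map V [Suc b..<n])
      = - prod_list (map V [0..<a] @ V a # map V [Suc a..<b] @ V b # map V [Suc b..<n])"
    using ab by (intro prod_list_swap) (auto intro!: V)
  ultimately show ?thesis by simp
qed

lemma sign_transpose_comp:
  assumes "\<sigma> permutes S" "finite S" "a \<noteq> b"
  shows "sign (Transposition.transpose a b \<circ> \<sigma>) = - sign \<sigma>"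
  using assms permutes_imp_permutation[OF assms(2,1)]
  by (simp add: sign_compose sign_swap_id permutation_swap_id)

lemma prod_list_permute:
  fixes V :: "nat \<Rightarrow> 'b::ring_1"
  assumes "\<sigma> permutes {..<n}"
    and "\<And>i j. i < n \<Longrightarrow> j < n \<Longrightarrow> i \<noteq> j \<Longrightarrow> V i * V j = - (V j * V i)"
  shows "prod_list (map (\<lambda>i. V (\<sigma> i)) [0..<n]) = of_int (sign \<sigma>) * prod_list (map V [0..<n])"
  using assms(1) finite_lessThan assms(2)
proof (induction arbitrary: V rule: permutes_induct)
  case id
  show ?case by simp
next
  case (swap a b p)
  let ?t = "Transposition.transpose a b"
  have ab: "a < n" "b < n" "a \<noteq> b" using swap.hyps by auto
  have t: "?t i < n" if "i < n" for i
    using that ab by (auto simp: Transposition.transpose_def)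
  have inj: "?t i \<noteq> ?t j" if "i \<noteq> j" for i j
    using that by (metis transpose_involutory)
  have "prod_list (map (\<lambda>i. V (?t (p i))) [0..<n])
      = of_int (sign p) * prod_list (map (\<lambda>i. V (?t i)) [0..<n])"
    by (rule swap.IH) (intro swap.prems t inj; assumption)
  also have "prod_list (map (\<lambda>i. V (?t i)) [0..<n]) = - prod_list (map V [0..<n])"
  proof (cases "a < b")
    case True
    show ?thesis
      by (rule prod_list_transpose[OF swap.prems True ab(2)])
  next
    case False
    then have "b < a" using ab by simp
    show ?thesis
      unfolding Transposition.transpose_commute[of a b]
      by (rule prod_list_transpose[OF swap.prems \<open>b < a\<close> ab(1)])
  qed
  also have "of_int (sign p) * - prod_list (map V [0..<n])
      = of_int (sign (?t \<circ> p)) * prod_list (map V [0..<n])"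
    using sign_transpose_comp[OF swap.hyps(4) finite_lessThan ab(3)] by simp
  finally show ?case by (simp only: comp_def)
qed

section \<open>The outer product\<close>

lemma orthogonal_cl_vec_anticommute:
  "orthogonal u v \<Longrightarrow> cl_vec u * cl_vec v = - (cl_vec v * cl_vec u)"
  using cl_vec_anticommute[of u v] by (simp add: orthogonal_def eq_neg_iff_add_eq_0)

text \<open>
  Orthogonal vectors anticommute, so all the signed terms in the antisymmetrization coincide.
\<close>

lemma wedge_orthogonal:
  assumes "sorted_wrt orthogonal us"
  shows "wedge us = prod_list (map cl_vec us)"
proof -
  let ?n = "length us"
  let ?D = "prod_list (map cl_vec us)"
  have orth: "orthogonal (us ! i) (us ! j)" if "i < ?n" "j < ?n" "i \<noteq> j" for i j
    using that assms unfolding sorted_wrt_iff_nth_less by (metis nat_neq_iff orthogonal_commute)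
  have D: "map (\<lambda>i. cl_vec (us ! i)) [0..<?n] = map cl_vec us"
    by (intro nth_equalityI) auto
  have "real_of_int (sign \<sigma>) *\<^sub>R prod_list (map (\<lambda>i. cl_vec (us ! \<sigma> i)) [0..<?n]) = ?D"
    if "\<sigma> permutes {..<?n}" for \<sigma>
  proof -
    have "prod_list (map (\<lambda>i. cl_vec (us ! \<sigma> i)) [0..<?n]) = of_int (sign \<sigma>) * ?D"
      unfolding D[symmetric]
      by (intro prod_list_permute that orthogonal_cl_vec_anticommute orth)
    then show ?thesis
      by (cases \<sigma> rule: sign_cases) simp_all
  qed
  then have "(\<Sum>\<sigma> | \<sigma> permutes {..<?n}.
        real_of_int (sign \<sigma>) *\<^sub>R prod_list (map (\<lambda>i. cl_vec (us ! \<sigma> i)) [0..<?n]))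
      = (\<Sum>\<sigma> | \<sigma> permutes {..<?n}. ?D)"
    by (intro sum.cong) auto
  also have "\<dots> = fact ?n *\<^sub>R ?D"
    by (simp add: scaleR_conv_of_real card_permutations[of "{..<?n}"])
  finally show ?thesis
    by (simp add: wedge_def)
qed

lemma linear_wedge: "linear (\<lambda>x. wedge (p @ x # q))"
proof -
  define N where "N = length p + Suc (length q)"
  have linear_term: "linear (\<lambda>x. prod_list (map (\<lambda>i. cl_vec ((p @ x # q) ! \<sigma> i)) [0..<N]))"
    if \<sigma>: "\<sigma> permutes {..<N}" for \<sigma>
  proof -
    obtain k where k: "k < N" "\<sigma> k = length p"
      using permutes_image[OF \<sigma>] unfolding N_def by (metis imageE lessThan_iff less_add_same_cancel1 zero_less_Suc)
    define g where "g i = cl_vec ((p @ 0 # q) ! \<sigma> i)" for i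
    have g: "cl_vec ((p @ x # q) ! \<sigma> i) = g i" if "i \<noteq> k" for i x
    proof -
      have "\<sigma> i \<noteq> length p"
        using that k(2) permutes_inj[OF \<sigma>] by (metis injD)
      then show ?thesis
        by (auto simp: g_def nth_append nth_Cons split: nat.splits)
    qed
    have "map (\<lambda>i. cl_vec ((p @ x # q) ! \<sigma> i)) [0..<N]
        = map g [0..<k] @ cl_vec x # map g [Suc k..<N]" for x
      using k by (auto simp: upt_split_at[of 0 k N] g)
    then have "prod_list (map (\<lambda>i. cl_vec ((p @ x # q) ! \<sigma> i)) [0..<N])
        = prod_list (map g [0..<k]) * cl_vec x * prod_list (map g [Suc k..<N])" for x
      by (simp add: mult.assoc)
    then show ?thesis
      by (auto intro!: linearI simp: linear_add[OF linear_cl_vec] linear_cmul[OF linear_cl_vec] algebra_simps)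
  qed
  have "linear (\<lambda>x. (1 / fact N) *\<^sub>R (\<Sum>\<sigma> | \<sigma> permutes {..<N}.
      real_of_int (sign \<sigma>) *\<^sub>R prod_list (map (\<lambda>i. cl_vec ((p @ x # q) ! \<sigma> i)) [0..<N])))"
    by (intro linear_compose_scale_right linear_compose_sum ballI linear_term) simp
  then show ?thesis
    by (simp add: wedge_def N_def)
qed

text \<open>
  Composing with the transposition of two positions that hold equal vectors negates every sign
  and keeps every product, so the sum is its own negative.
\<close>

lemma wedge_repeated:
  assumes "\<not> distinct us"
  shows "wedge us = 0"
proof -
  let ?n = "length us"
  let ?T = "\<lambda>\<sigma>. real_of_int (sign \<sigma>) *\<^sub>R prod_list (map (\<lambda>i. cl_vec (us ! \<sigma> i)) [0..<?n])"
  let ?S = "\<Sum>\<sigma> | \<sigma> permutes {..<?n}. ?T \<sigma>"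
  obtain i j where ij: "i < ?n" "j < ?n" "i \<noteq> j" "us ! i = us ! j"
    using assms by (auto simp: distinct_conv_nth)
  let ?t = "Transposition.transpose i j"
  have t: "?t permutes {..<?n}"
    using ij by (intro permutes_swap_id) auto
  have nth: "us ! ?t k = us ! k" for k
    using ij by (auto simp: Transposition.transpose_def)
  have "?S = (\<Sum>\<sigma> | \<sigma> permutes {..<?n}. ?T (?t \<circ> \<sigma>))"
    by (rule setum_permutations_compose_left[OF t])
  also have "\<dots> = (\<Sum>\<sigma> | \<sigma> permutes {..<?n}. - ?T \<sigma>)"
  proof (intro sum.cong refl)
    fix \<sigma> assume "\<sigma> \<in> {\<sigma>. \<sigma> permutes {..<?n}}"
    then have "sign (?t \<circ> \<sigma>) = - sign \<sigma>"
      using ij by (intro sign_transpose_comp) auto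
    then show "?T (?t \<circ> \<sigma>) = - ?T \<sigma>"
      by (simp add: nth)
  qed
  finally have "?S + ?S = 0"
    by (simp only: sum_negf eq_neg_iff_add_eq_0)
  then have "?S = 0"
    by (simp flip: scaleR_2)
  then show ?thesis
    by (simp add: wedge_def)
qed

text \<open>
  By linearity the difference of the two sides is the outer product with \<open>w\<close> in the distinguished
  place, which as a function of \<open>w\<close> vanishes at all the other factors.
\<close>

lemma wedge_add_span:
  assumes "w \<in> span (set p \<union> set q)"
  shows "wedge (p @ (x + w) # q) = wedge (p @ x # q)"
proof -
  have "wedge (p @ w # q) = 0"
    by (rule linear_eq_0_on_span[OF linear_wedge _ assms]) (auto intro: wedge_repeated)
  then show ?thesis
    by (simp add: linear_add[OF linear_wedge])
qed

lemma wedge_add_to_tail: "wedge (p @ x # map (\<lambda>y. y + x) q) = wedge (p @ x # q)"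
proof -
  have "wedge (p @ x # r @ map (\<lambda>y. y + x) q) = wedge (p @ x # r @ q)" for r
  proof (induction q arbitrary: r)
    case (Cons y q)
    have "wedge ((p @ x # r) @ (y + x) # map (\<lambda>y. y + x) q) = wedge ((p @ x # r) @ y # map (\<lambda>y. y + x) q)"
      by (intro wedge_add_span span_base) simp
    then show ?case
      using Cons[of "r @ [y]"] by simp
  qed simp
  from this[of "[]"] show ?thesis by simp
qed

section \<open>Omitting a factor from an orthogonal blade\<close>

text \<open>
  The vector passes the factors in \<open>p\<close>, one sign for each, and then meets its own copy, where it
  contracts to its square.
\<close>

lemma cl_vec_mult_orthogonal_prod:
  assumes "sorted_wrt orthogonal (p @ v # q)"
  shows "cl_vec v * prod_list (map cl_vec (p @ v # q))
    = ((-1) ^ length p * (v \<bullet> v)) *\<^sub>R prod_list (map cl_vec (p @ q))"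
proof -
  define P where "P = prod_list (map cl_vec p)"
  have "cl_vec v * P = (-1) ^ length p * (P * cl_vec v)"
  proof -
    have "orthogonal v u" if "u \<in> set p" for u
      using that assms by (auto simp: sorted_wrt_append orthogonal_commute)
    then have "cl_vec v * z = - (z * cl_vec v)" if "z \<in> set (map cl_vec p)" for z
      using that orthogonal_cl_vec_anticommute by auto
    then show ?thesis
      using anticommute_prod_list[of "map cl_vec p" "cl_vec v"] by (simp only: P_def length_map)
  qed
  then have "cl_vec v * P = (-1) ^ length p *\<^sub>R (P * cl_vec v)"
    by (cases "even (length p)") simp_all
  then have "(cl_vec v * P) * cl_vec v = ((-1) ^ length p * (v \<bullet> v)) *\<^sub>R P"
    by (simp add: mult.assoc cl_vec_square)
  then have "(cl_vec v * P * cl_vec v) * prod_list (map cl_vec q)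
      = ((-1) ^ length p * (v \<bullet> v)) *\<^sub>R P * prod_list (map cl_vec q)"
    by simp
  then show ?thesis
    by (simp add: P_def mult.assoc)
qed

lemma prod_cl_vec_zero: "0 \<in> set us \<Longrightarrow> prod_list (map cl_vec us) = 0"
  by (induction us) (auto simp: linear_0[OF linear_cl_vec])

lemma prod_cl_vec_inverse:
  assumes "0 \<notin> set us"
  shows "\<exists>y. prod_list (map cl_vec us) * y = 1 \<and> y * prod_list (map cl_vec us) = 1"
  using assms
proof (induction us)
  case (Cons u us)
  then obtain y where y: "prod_list (map cl_vec us) * y = 1" "y * prod_list (map cl_vec us) = 1"
    by auto
  define w where "w = cl_vec ((1 / (u \<bullet> u)) *\<^sub>R u)"
  have w: "cl_vec u * w = 1" "w * cl_vec u = 1"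
    using Cons.prems by (simp_all add: w_def linear_cmul[OF linear_cl_vec] cl_vec_square)
  have "cl_vec u * prod_list (map cl_vec us) * (y * w) = cl_vec u * (prod_list (map cl_vec us) * y) * w"
    by (simp add: mult.assoc)
  moreover have "y * w * (cl_vec u * prod_list (map cl_vec us)) = y * (w * cl_vec u) * prod_list (map cl_vec us)"
    by (simp add: mult.assoc)
  ultimately show ?case
    using y w by (intro exI[of _ "y * w"]) simp
qed simp

text \<open>
  On the right is \<open>v\<^sup>-\<^sup>1\<close> up to sign: this turns the quotient of blades in the mean
  multi-difference into the reciprocal of a single vector.
\<close>

lemma omit_mult_inverse:
  assumes "sorted_wrt orthogonal (p @ v # q)" "0 \<notin> set (p @ v # q)"
  shows "wedge (p @ q) * inverse (wedge (p @ v # q)) = ((-1) ^ length p / (norm v)\<^sup>2) *\<^sub>R cl_vec v"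
proof -
  define D where "D = prod_list (map cl_vec (p @ v # q))"
  have D: "wedge (p @ v # q) = D"
    unfolding D_def using assms(1) by (rule wedge_orthogonal)
  have "wedge (p @ q) = prod_list (map cl_vec (p @ q))"
    using assms(1) by (intro wedge_orthogonal) (simp add: sorted_wrt_append)
  also have "\<dots> = ((-1) ^ length p / (v \<bullet> v)) *\<^sub>R (cl_vec v * D)"
    using assms(2) unfolding D_def cl_vec_mult_orthogonal_prod[OF assms(1)]
    by (simp flip: power_add)
  finally have pq: "wedge (p @ q) = ((-1) ^ length p / (norm v)\<^sup>2) *\<^sub>R (cl_vec v * D)"
    by (simp add: power2_norm_eq_inner)
  obtain y where "D * y = 1" "y * D = 1"
    using prod_cl_vec_inverse[OF assms(2)] unfolding D_def by blast
  then have "D * inverse D = 1"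
    by (simp add: clifford_inverse_eqI)
  then show ?thesis
    unfolding D pq by (simp add: mult.assoc)
qed

section \<open>Orthogonalizing a simplex\<close>

definition altitude :: "(nat \<Rightarrow> 'a::euclidean_space) \<Rightarrow> nat \<Rightarrow> 'a" where
  "altitude a i = orth_proj (affine hull (a ` {i + 1..DIM('a) + 1})) (a i) - a i"

lemma mirror_diff: "mirror a i - a i = 2 *\<^sub>R altitude a i"
  by (simp add: mirror_def altitude_def scaleR_2 algebra_simps)

lemma altitude_orthogonal:
  fixes a :: "nat \<Rightarrow> 'a::euclidean_space"
  assumes "i \<le> DIM('a)" "u \<in> affine hull (a ` {i + 1..DIM('a) + 1})"
    "w \<in> affine hull (a ` {i + 1..DIM('a) + 1})"
  shows "orthogonal (altitude a i) (u - w)"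
proof -
  have "orthogonal (- (a i - orth_proj (affine hull (a ` {i + 1..DIM('a) + 1})) (a i))) (u - w)"
    by (intro orthogonal_clauses orth_proj_affine assms) (use assms in auto)
  then show ?thesis by (simp add: altitude_def)
qed

text \<open>
  The vectors whose reciprocals occur in the result, in one sequence: listing the last edge after
  the mirror differences makes both kinds of blades in the mean multi-difference instances of
  omitting one member.
\<close>

definition frame :: "(nat \<Rightarrow> 'a::euclidean_space) \<Rightarrow> nat \<Rightarrow> 'a" where
  "frame a i = (if i < DIM('a) then mirror a i - a i else a (i + 1) - a i)"

text \<open>
  The hulls of the final segments of the vertices are nested, and every later member of the frame
  is a multiple of a difference of two points in the hull from which \<open>altitude a i\<close> is erected.
\<close>

lemma frame_orthogonal:
  fixes a :: "nat \<Rightarrow> 'a::euclidean_space"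
  assumes "i < j" "j \<le> DIM('a)"
  shows "orthogonal (frame a i) (frame a j)"
proof -
  let ?H = "\<lambda>k. affine hull (a ` {k + 1..DIM('a) + 1})"
  have a: "a k \<in> ?H i" if "i < k" "k \<le> DIM('a) + 1" for k
    using that by (intro hull_inc) auto
  have "orth_proj (?H j) (a j) \<in> ?H j"
    using assms by (intro orth_proj_affine) auto
  moreover have "?H j \<subseteq> ?H i"
    using assms by (intro hull_mono image_mono) auto
  ultimately have "orth_proj (?H j) (a j) \<in> ?H i" by blast
  then have "orthogonal (altitude a i) (altitude a j)"
    unfolding altitude_def[of a j] using assms by (intro altitude_orthogonal a) auto
  moreover have "orthogonal (altitude a i) (a (j + 1) - a j)"
    using assms by (intro altitude_orthogonal a) auto
  ultimately show ?thesis
    using assms by (auto simp add: frame_def mirror_diff orthogonal_clauses)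
qed

lemma frame_sorted_orthogonal:
  fixes a :: "nat \<Rightarrow> 'a::euclidean_space"
  shows "sorted_wrt orthogonal (map (frame a) [1..<DIM('a) + 1])"
  by (auto simp: sorted_wrt_iff_nth_less nth_append simp del: upt_Suc intro!: frame_orthogonal)

text \<open>
  One step of the Gram-Schmidt process. First the edge from \<open>a i\<close> to \<open>a (i + 1)\<close> is subtracted from
  the other edges at \<open>a i\<close>, which moves their origin to \<open>a (i + 1)\<close>. These new edges span the
  directions of the hull of the later vertices, so the component of the first edge along
  that hull can be removed, and the altitude is left.
\<close>

lemma wedge_altitude_step:
  fixes a :: "nat \<Rightarrow> 'a::euclidean_space"
  assumes "i \<le> DIM('a)"
  shows "wedge (p @ map (\<lambda>j. a j - a i) [i + 1..<DIM('a) + 2])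
    = wedge (p @ altitude a i # map (\<lambda>j. a j - a (i + 1)) [i + 2..<DIM('a) + 2])"
proof -
  let ?b = "a (i + 1)"
  let ?x = "?b - a i"
  let ?q = "map (\<lambda>j. a j - ?b) [i + 2..<DIM('a) + 2]"
  let ?H = "affine hull (a ` {i + 1..DIM('a) + 1})"
  define w where "w = ?b - orth_proj ?H (a i)"
  have "orth_proj ?H (a i) \<in> ?H"
    using assms by (intro orth_proj_affine) auto
  moreover have "?b \<in> a ` {i + 1..DIM('a) + 1}"
    using assms by auto
  ultimately obtain v where v: "orth_proj ?H (a i) = ?b + v"
      "v \<in> span {x - ?b |x. x \<in> a ` {i + 1..DIM('a) + 1} - {?b}}"
    unfolding affine_hull_span[OF \<open>?b \<in> _\<close>] by blast
  have "{x - ?b |x. x \<in> a ` {i + 1..DIM('a) + 1} - {?b}} \<subseteq> set ?q"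
  proof (rule subsetI)
    fix z assume "z \<in> {x - ?b |x. x \<in> a ` {i + 1..DIM('a) + 1} - {?b}}"
    then obtain j where j: "j \<in> {i + 1..DIM('a) + 1}" "a j \<noteq> ?b" "z = a j - ?b"
      by blast
    have "j \<noteq> i + 1" using j(2) by metis
    then have "j \<in> set [i + 2..<DIM('a) + 2]" using j(1) by auto
    then show "z \<in> set ?q" unfolding j(3) set_map by (rule imageI)
  qed
  then have "v \<in> span (set p \<union> set ?q)"
    using v(2) span_mono[OF le_supI2] by blast
  then have "- v \<in> span (set p \<union> set ?q)"
    by (rule span_neg)
  then have w: "w \<in> span (set p \<union> set ?q)"
    unfolding w_def v(1) by (simp only: diff_diff_add[symmetric] diff_self diff_0)
  have "map (\<lambda>j. a j - a i) [i + 1..<DIM('a) + 2] = ?x # map (\<lambda>y. y + ?x) ?q"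
    using assms by (simp add: upt_conv_Cons del: upt_Suc)
  then have "wedge (p @ map (\<lambda>j. a j - a i) [i + 1..<DIM('a) + 2]) = wedge (p @ ?x # ?q)"
    by (simp only: wedge_add_to_tail)
  also have "?x = altitude a i + w"
    by (simp add: altitude_def w_def)
  also have "wedge (p @ (altitude a i + w) # ?q) = wedge (p @ altitude a i # ?q)"
    by (rule wedge_add_span[OF w])
  finally show ?thesis .
qed

lemma simplex_blade_altitudes:
  fixes a :: "nat \<Rightarrow> 'a::euclidean_space"
  assumes "k \<le> DIM('a)"
  shows "simplex_blade a
    = wedge (map (altitude a) [1..<k + 1] @ map (\<lambda>j. a j - a (k + 1)) [k + 2..<DIM('a) + 2])"
  using assms
proof (induction k)
  case (Suc k)
  then show ?case
    using wedge_altitude_step[of "k + 1" "map (altitude a) [1..<k + 1]" a] by simp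
qed (simp add: simplex_blade_def numeral_2_eq_2)

text \<open>
  The last step of the process is omitted: it would replace the edge from \<open>a n\<close> to \<open>a (n + 1)\<close>
  by the altitude to a single point, which is that same edge. This is why the exponent of 2 is
  one less than the dimension.
\<close>

lemma simplex_blade_frame:
  fixes a :: "nat \<Rightarrow> 'a::euclidean_space"
  shows "simplex_blade a = (1 / 2 ^ (DIM('a) - 1)) *\<^sub>R wedge (map (frame a) [1..<DIM('a) + 1])"
proof -
  define n where "n = DIM('a)"
  have n: "n \<ge> 1" by (simp add: n_def Suc_leI)
  \<comment> \<open>the altitudes, followed by the last edge\<close>
  let ?h = "\<lambda>i. if i < n then (1 / 2) *\<^sub>R frame a i else frame a i"
  have upt: "[1..<n + 1] = [1..<n] @ [n]" using n by simp
  have sorted: "sorted_wrt orthogonal (map (frame a) [1..<n + 1])"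
    unfolding n_def by (rule frame_sorted_orthogonal)
  have "simplex_blade a = wedge (map ?h [1..<n + 1])"
  proof -
    have "map ?h [1..<n + 1] = map (altitude a) [1..<n] @ [a (n + 1) - a n]"
      unfolding upt by (auto simp: frame_def mirror_diff n_def)
    then show ?thesis
      using simplex_blade_altitudes[of "n - 1" a] n by (simp only: n_def[symmetric]) simp
  qed
  also have "\<dots> = prod_list (map cl_vec (map ?h [1..<n + 1]))"
    by (intro wedge_orthogonal)
      (auto simp: sorted_wrt_iff_nth_less n_def orthogonal_clauses simp del: upt_Suc
        intro!: frame_orthogonal orthogonal_clauses)
  also have "\<dots> = prod_list (map (\<lambda>i. (1 / 2) *\<^sub>R cl_vec (frame a i)) [1..<n]) * cl_vec (frame a n)"
  proof -
    have "map cl_vec (map ?h [1..<n + 1]) = map (\<lambda>i. (1 / 2) *\<^sub>R cl_vec (frame a i)) [1..<n] @ [cl_vec (frame a n)]"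
      unfolding upt by (auto simp: linear_cmul[OF linear_cl_vec])
    then show ?thesis by simp
  qed
  also have "prod_list (map (\<lambda>i. (1 / 2) *\<^sub>R cl_vec (frame a i)) is)
      = (1 / 2) ^ length is *\<^sub>R prod_list (map (\<lambda>i. cl_vec (frame a i)) is)" for "is"
    by (induction "is") simp_all
  finally have "simplex_blade a = (1 / 2) ^ (n - 1) *\<^sub>R prod_list (map cl_vec (map (frame a) [1..<n + 1]))"
    unfolding upt by (simp add: comp_def)
  then show ?thesis
    using wedge_orthogonal[OF sorted] by (simp add: power_one_over n_def)
qed

section \<open>The mean multi-difference quotient\<close>

theorem proposition5p2:
  fixes \<Omega> :: "'a::euclidean_space set" and f :: "'a \<Rightarrow> real"
    and a :: "nat \<Rightarrow> 'a" and n :: nat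
  assumes "n = DIM('a)" and "n > 3"
    and "\<And>i. i \<in> {1..n + 1} \<Longrightarrow> a i \<in> \<Omega>"
    and "simplex_blade a \<noteq> 0"
    and "\<And>i. i \<in> {1..n - 1} \<Longrightarrow> mirror a i \<in> \<Omega>"
  shows "mean_multidiff f a * inverse (simplex_blade a) =
      (\<Sum>i = 1..n - 1. of_real (f (mirror a i) - f (a i)) / cl_vec (mirror a i - a i))
      + of_real (f (a (n + 1)) - f (a n)) / cl_vec (a (n + 1) - a n)"
proof -
  let ?us = "map (frame a) [1..<n + 1]"
  define E where "E = wedge ?us"
  have sorted: "sorted_wrt orthogonal ?us"
    unfolding assms(1) by (rule frame_sorted_orthogonal)
  have blade: "simplex_blade a = (1 / 2 ^ (n - 1)) *\<^sub>R E"
    using simplex_blade_frame[of a] assms(1) by (simp add: E_def)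
  have nz: "0 \<notin> set ?us"
  proof
    assume "0 \<in> set ?us"
    then have "prod_list (map cl_vec ?us) = 0"
      by (rule prod_cl_vec_zero)
    then show False
      using assms(4) blade wedge_orthogonal[OF sorted] by (simp add: E_def)
  qed
  obtain y where y: "E * y = 1" "y * E = 1"
    using prod_cl_vec_inverse[OF nz] wedge_orthogonal[OF sorted] unfolding E_def by auto
  have inv: "inverse (simplex_blade a) = 2 ^ (n - 1) *\<^sub>R inverse E"
    unfolding blade clifford_inverse_eqI[OF y]
    by (rule clifford_inverse_eqI) (use y in simp_all)
  \<comment> \<open>The sign of the mean multi-difference is included here, so that no sign is left.\<close>
  have omit: "((-1) ^ (i + 1) * c) *\<^sub>R wedge (map (frame a) (filter (\<lambda>j. j \<noteq> i) [1..<n + 1])) * inverse E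
      = of_real c / cl_vec (frame a i)" if "1 \<le> i" "i \<le> n" for i c
  proof -
    let ?p = "map (frame a) [1..<i]" and ?q = "map (frame a) [Suc i..<n + 1]"
    have upt: "[1..<n + 1] = [1..<i] @ i # [Suc i..<n + 1]"
      using that by (intro upt_split_at) auto
    then have us: "?us = ?p @ frame a i # ?q" by simp
    have "filter (\<lambda>j. j \<noteq> i) [1..<n + 1] = [1..<i] @ [Suc i..<n + 1]"
      unfolding upt by (auto simp: filter_id_conv)
    then have "wedge (map (frame a) (filter (\<lambda>j. j \<noteq> i) [1..<n + 1])) * inverse E
        = ((-1) ^ (i - 1) / (norm (frame a i))\<^sup>2) *\<^sub>R cl_vec (frame a i)"
      using omit_mult_inverse[of ?p "frame a i" ?q] sorted nz
      by (simp only: E_def us map_append length_map length_upt simp_thms)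
    moreover have "(-1) ^ (i + 1) * (-1) ^ (i - 1) = (1 :: real)"
      using that by (simp flip: power_add)
    moreover have "frame a i \<noteq> 0"
      using nz unfolding us by auto
    ultimately show ?thesis
      by (simp add: cl_divide_vec linear_cmul[OF linear_cl_vec] field_simps)
  qed
  have last: "mirror_blade a = wedge (map (frame a) (filter (\<lambda>j. j \<noteq> n) [1..<n + 1]))"
    using assms(1,2) by (auto simp: mirror_blade_def frame_def filter_id_conv intro!: arg_cong[of _ _ wedge])
  have rest: "mirror_blade_omit a i = wedge (map (frame a) (filter (\<lambda>j. j \<noteq> i) [1..<n + 1]))"
    if "i \<in> {1..n - 1}" for i
    using that assms(1,2) by (auto simp: mirror_blade_omit_def frame_def intro!: arg_cong[of _ _ wedge])
  have "mean_multidiff f a * inverse (simplex_blade a)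
      = (\<Sum>i = 1..n - 1. ((-1) ^ (i + 1) * (f (mirror a i) - f (a i))) *\<^sub>R mirror_blade_omit a i * inverse E)
        + ((-1) ^ (n + 1) * (f (a (n + 1)) - f (a n))) *\<^sub>R mirror_blade a * inverse E"
    unfolding inv mean_multidiff_def assms(1)[symmetric]
    by (simp only: mult_scaleR_left mult_scaleR_right scaleR_scaleR distrib_right sum_distrib_right) simp
  also have "\<dots> = (\<Sum>i = 1..n - 1. of_real (f (mirror a i) - f (a i)) / cl_vec (frame a i))
      + of_real (f (a (n + 1)) - f (a n)) / cl_vec (frame a n)"
    using assms(2) by (intro arg_cong2[of _ _ _ _ "(+)"] sum.cong refl) (auto simp only: rest last omit atLeastAtMost_iff)
  also have "(\<Sum>i = 1..n - 1. of_real (f (mirror a i) - f (a i)) / cl_vec (frame a i))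
      = (\<Sum>i = 1..n - 1. of_real (f (mirror a i) - f (a i)) / cl_vec (mirror a i - a i))"
    using assms(1,2) by (intro sum.cong) (auto simp: frame_def)
  also have "frame a n = a (n + 1) - a n"
    by (simp add: frame_def assms(1))
  finally show ?thesis .
qed

end
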